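(* Let $J$ be a WOT-closed two-sided ideal of $F_n^\infty$ such that $1\in\mathcal N_J$ and let $\mathcal D$ be a Hilbert space. Let $\mathcal M\subseteq\mathcal N_J\otimes\mathcal D$ be a co-invariant subspace under $B_i\otimes I_{\mathcal D}$, $i=1,\ldots,n$. Then the following statements are equivalent: (i) $\mathcal M$ is a cyclic subspace for $B_i\otimes I_{\mathcal D}$, $i=1,\ldots,n$; (ii) $P_0\mathcal M=\mathcal D$; (iii) $\mathcal M^\perp\cap\mathcal D=\{0\}$. Here $P_0$ is the orthogonal projection of $\mathcal N_J\otimes\mathcal D$ onto $1\otimes\mathcal D$, the latter being identified with $\mathcal D$, and $\mathcal M^\perp$ is the orthogonal complement of $\mathcal M$ in $\mathcal N_J\otimes\mathcal D$.
   Context: Let $n\in\{1,2,\dots\}$ and let $F^2(H_n)=\bigoplus_{k\ge 0}H_n^{\otimes k}$ be the full Fock space of an $n$-dimensional complex Hilbert space $H_n$ with orthonormal basis $e_1,\dots,e_n$ (with $H_n^{\otimes 0}=\mathbb C1$). The left creation operators are $S_i\varphi=e_i\otimes\varphi$, $\varphi\in F^2(H_n)$. $F_n^\infty\subset B(F^2(H_n))$ is the WOT-closed algebra generated by $S_1,\dots,S_n$ and the identity. For a WOT-closed two-sided ideal $J$ of $F_n^\infty$, put $\mathcal N_J=F^2(H_n)\ominus\overline{JF^2(H_n)}$ and $B_i=P_{\mathcal N_J}S_i|_{\mathcal N_J}$, $i=1,\dots,n$, where $P_{\mathcal N_J}$ is the orthogonal projection onto $\mathcal N_J$. A subspace is co-invariant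 under a set of operators if it is invariant under their adjoints. A subspace $\mathcal M$ of a Hilbert space $\mathcal X$ is cyclic for a set of operators on $\mathcal X$ if $\mathcal X$ is the closed linear span of the vectors $Xh$, where $h\in\mathcal M$ and $X$ ranges over the (nonselfadjoint) algebra generated by these operators and the identity, i.e., $\mathcal X$ is the smallest closed subspace that contains $\mathcal M$ and is invariant under these operators.
   Formalization: Condition (ii) is stated as "the closure of P_0 M equals D", since for infinite-dimensional D the literal equality P_0 M = D can fail although M is cyclic (P_0 M may be a proper dense subspace of D); for finite-dimensional D the two coincide. *)

theory Defs
  imports "HOL-Analysis.Analysis"
begin

section \<open>Complex Hilbert spaces\<close>

text \<open>
  The inner product is conjugate-linear in the first and linear in the second argument.  The norm
  and the topology are those of the underlying real inner product space, whose inner product is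
  the real part of the complex one.
\<close>

class scaleC =
  fixes scaleC :: "complex \<Rightarrow> 'a \<Rightarrow> 'a" (infixr "*\<^sub>C" 75)

class complex_inner = real_inner + scaleC +
  fixes cinner :: "'a \<Rightarrow> 'a \<Rightarrow> complex"
  assumes scaleC_add_right: "a *\<^sub>C (x + y) = a *\<^sub>C x + a *\<^sub>C y"
    and scaleC_add_left: "(a + b) *\<^sub>C x = a *\<^sub>C x + b *\<^sub>C x"
    and scaleC_scaleC: "a *\<^sub>C b *\<^sub>C x = (a * b) *\<^sub>C x"
    and scaleC_one [simp]: "1 *\<^sub>C x = x"
    and scaleR_scaleC: "r *\<^sub>R x = complex_of_real r *\<^sub>C x"
    and cinner_commute: "cinner x y = cnj (cinner y x)"
    and cinner_add_left: "cinner (x + y) z = cinner x z + cinner y z"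
    and cinner_scaleC_left: "cinner (a *\<^sub>C x) y = cnj a * cinner x y"
    and Re_cinner: "Re (cinner x y) = inner x y"

class chilbert_space = complex_inner + complete_space

global_interpretation complex_vector: vector_space "scaleC :: complex \<Rightarrow> 'a \<Rightarrow> 'a :: complex_inner"
  defines csubspace = complex_vector.subspace
    and cspan = complex_vector.span
  by unfold_locales (simp_all add: scaleC_add_right scaleC_add_left scaleC_scaleC)

lemma cinner_add_right: "cinner x (y + z) = cinner x y + cinner x (z :: 'a :: complex_inner)"
  by (metis cinner_add_left cinner_commute complex_cnj_add)

lemma cinner_scaleC_right: "cinner x (a *\<^sub>C y) = a * cinner x (y :: 'a :: complex_inner)"
  by (metis cinner_commute cinner_scaleC_left complex_cnj_cnj complex_cnj_mult)

lemma norm_scaleC: "norm (a *\<^sub>C x) = cmod a * norm (x :: 'a :: complex_inner)"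
proof -
  have "cinner x x = complex_of_real (inner x x)"
    using arg_cong [OF cinner_commute [of x x], of Im] by (simp add: complex_eq_iff Re_cinner)
  moreover have "inner (a *\<^sub>C x) (a *\<^sub>C x) = Re ((a * cnj a) * cinner x x)"
    by (simp add: Re_cinner [symmetric] cinner_scaleC_left cinner_scaleC_right mult_ac)
  ultimately have "inner (a *\<^sub>C x) (a *\<^sub>C x) = (cmod a)\<^sup>2 * inner x x"
    by (simp add: complex_norm_square [symmetric])
  then show ?thesis
    by (simp add: norm_eq_sqrt_inner real_sqrt_mult)
qed

lemma Im_cinner: "Im (cinner x y) = inner (\<i> *\<^sub>C x) (y :: 'a :: complex_inner)"
  by (simp add: Re_cinner [symmetric] cinner_scaleC_left)

lemma cmod_cinner_le: "cmod (cinner x y) \<le> (norm x)\<^sup>2 + (norm (y :: 'a :: complex_inner))\<^sup>2"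
proof -
  have "cmod (cinner x y) \<le> \<bar>inner x y\<bar> + \<bar>inner (\<i> *\<^sub>C x) y\<bar>"
    using cmod_le [of "cinner x y"] by (simp add: Re_cinner Im_cinner)
  also have "\<dots> \<le> norm x * norm y + norm x * norm y"
    using Cauchy_Schwarz_ineq2 [of x y] Cauchy_Schwarz_ineq2 [of "\<i> *\<^sub>C x" y]
    by (simp add: norm_scaleC)
  also have "\<dots> \<le> (norm x)\<^sup>2 + (norm y)\<^sup>2"
    using sum_squares_bound [of "norm x" "norm y"] by simp
  finally show ?thesis .
qed

instantiation complex :: chilbert_space
begin

definition "scaleC a x = a * (x :: complex)"

definition "cinner x y = cnj x * (y :: complex)"

instance
  by intro_classes
    (simp_all add: scaleC_complex_def cinner_complex_def inner_complex_def algebra_simps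
      scaleR_conv_of_real)

end


section \<open>Square summable families of vectors\<close>

typedef (overloaded) ('i, 'a :: real_inner) ell2 =
  "{f :: 'i \<Rightarrow> 'a. (\<lambda>i. (norm (f i))\<^sup>2) summable_on UNIV}"
  morphisms coord Abs_ell2
  by (rule exI [of _ "\<lambda>_. 0"]) simp

setup_lifting type_definition_ell2

lemma summable_coord: "(\<lambda>i. (norm (coord x i))\<^sup>2) summable_on UNIV"
  using coord [of x] by simp

lemma ell2_eqI: "(\<And>i. coord x i = coord y i) \<Longrightarrow> x = y"
  by (simp add: coord_inject [symmetric] fun_eq_iff)

lemma norm_add_square_le: "(norm (x + y))\<^sup>2 \<le> 2 * (norm x)\<^sup>2 + 2 * (norm (y :: 'a :: real_inner))\<^sup>2"
proof -
  have "(norm (x + y))\<^sup>2 \<le> (norm x + norm y)\<^sup>2"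
    by (simp add: norm_triangle_ineq power_mono)
  also have "\<dots> \<le> 2 * (norm x)\<^sup>2 + 2 * (norm y)\<^sup>2"
    using sum_squares_bound [of "norm x" "norm y"] by (simp add: power2_sum)
  finally show ?thesis .
qed

lemma square_summable_add:
  fixes f g :: "'i \<Rightarrow> 'a :: real_inner"
  assumes "(\<lambda>i. (norm (f i))\<^sup>2) summable_on UNIV" "(\<lambda>i. (norm (g i))\<^sup>2) summable_on UNIV"
  shows "(\<lambda>i. (norm (f i + g i))\<^sup>2) summable_on UNIV"
proof (rule summable_on_comparison_test)
  show "(\<lambda>i. 2 * (norm (f i))\<^sup>2 + 2 * (norm (g i))\<^sup>2) summable_on UNIV"
    by (intro summable_on_add summable_on_cmult_right assms)
qed (use norm_add_square_le in auto)

lemma summable_inner_coord: "(\<lambda>i. inner (coord x i) (coord y i)) summable_on UNIV"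
proof (rule abs_summable_summable, rule summable_on_comparison_test)
  show "(\<lambda>i. (norm (coord x i))\<^sup>2 + (norm (coord y i))\<^sup>2) summable_on UNIV"
    by (intro summable_on_add summable_coord)
  show "norm (inner (coord x i) (coord y i)) \<le> (norm (coord x i))\<^sup>2 + (norm (coord y i))\<^sup>2" for i
    using Cauchy_Schwarz_ineq2 [of "coord x i" "coord y i"]
      sum_squares_bound [of "norm (coord x i)" "norm (coord y i)"]
      mult_nonneg_nonneg [of "norm (coord x i)" "norm (coord y i)"]
    by simp
qed auto

lemma summable_cinner_coord:
  "(\<lambda>i. cinner (coord x i) (coord y i :: 'a :: complex_inner)) summable_on UNIV"
proof (rule abs_summable_summable, rule summable_on_comparison_test)
  show "(\<lambda>i. (norm (coord x i))\<^sup>2 + (norm (coord y i))\<^sup>2) summable_on UNIV"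
    by (intro summable_on_add summable_coord)
qed (auto simp: cmod_cinner_le)

instantiation ell2 :: (type, real_inner) real_vector
begin

lift_definition zero_ell2 :: "('a, 'b) ell2" is "\<lambda>_. 0" by simp

lift_definition plus_ell2 :: "('a, 'b) ell2 \<Rightarrow> ('a, 'b) ell2 \<Rightarrow> ('a, 'b) ell2"
  is "\<lambda>f g i. f i + g i" by (rule square_summable_add)

lift_definition uminus_ell2 :: "('a, 'b) ell2 \<Rightarrow> ('a, 'b) ell2"
  is "\<lambda>f i. - f i" by simp

lift_definition minus_ell2 :: "('a, 'b) ell2 \<Rightarrow> ('a, 'b) ell2 \<Rightarrow> ('a, 'b) ell2"
  is "\<lambda>f g i. f i - g i"
proof -
  fix f g :: "'a \<Rightarrow> 'b"
  assume "(\<lambda>i. (norm (f i))\<^sup>2) summable_on UNIV" "(\<lambda>i. (norm (g i))\<^sup>2) summable_on UNIV"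
  then show "(\<lambda>i. (norm (f i - g i))\<^sup>2) summable_on UNIV"
    using square_summable_add [of f "\<lambda>i. - g i"] by simp
qed

lift_definition scaleR_ell2 :: "real \<Rightarrow> ('a, 'b) ell2 \<Rightarrow> ('a, 'b) ell2"
  is "\<lambda>r f i. r *\<^sub>R f i"
  by (simp add: power_mult_distrib summable_on_cmult_right)

instance
proof
  fix x y z :: "('a, 'b) ell2" and r s :: real
  show "x + y + z = x + (y + z)" "x + y = y + x" "0 + x = x" "- x + x = 0" "x - y = x + - y"
    "r *\<^sub>R (x + y) = r *\<^sub>R x + r *\<^sub>R y" "(r + s) *\<^sub>R x = r *\<^sub>R x + s *\<^sub>R x"
    "r *\<^sub>R s *\<^sub>R x = (r * s) *\<^sub>R x" "1 *\<^sub>R x = x"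
    by (transfer; simp add: algebra_simps)+
qed

end

instantiation ell2 :: (type, real_inner) real_inner
begin

definition inner_ell2 :: "('a, 'b) ell2 \<Rightarrow> ('a, 'b) ell2 \<Rightarrow> real" where
  "inner_ell2 x y = (\<Sum>\<^sub>\<infinity>i. inner (coord x i) (coord y i))"

definition norm_ell2 :: "('a, 'b) ell2 \<Rightarrow> real" where
  "norm_ell2 x = sqrt (inner x x)"

definition sgn_ell2 :: "('a, 'b) ell2 \<Rightarrow> ('a, 'b) ell2" where
  "sgn_ell2 x = x /\<^sub>R norm x"

definition dist_ell2 :: "('a, 'b) ell2 \<Rightarrow> ('a, 'b) ell2 \<Rightarrow> real" where
  "dist_ell2 x y = norm (x - y)"

definition uniformity_ell2 :: "(('a, 'b) ell2 \<times> ('a, 'b) ell2) filter" where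
  "uniformity_ell2 = (INF e\<in>{0 <..}. principal {(x, y). dist x y < e})"

definition open_ell2 :: "('a, 'b) ell2 set \<Rightarrow> bool" where
  "open_ell2 U \<longleftrightarrow> (\<forall>x\<in>U. eventually (\<lambda>(x', y). x' = x \<longrightarrow> y \<in> U) uniformity)"

instance
proof
  fix x y z :: "('a, 'b) ell2" and r :: real
  show "inner x y = inner y x"
    by (simp add: inner_ell2_def inner_commute)
  show "inner (x + y) z = inner x z + inner y z"
    by (simp add: inner_ell2_def plus_ell2.rep_eq inner_add_left infsum_add summable_inner_coord)
  show "inner (r *\<^sub>R x) y = r * inner x y"
    by (simp add: inner_ell2_def scaleR_ell2.rep_eq infsum_cmult_right summable_inner_coord)
  show "0 \<le> inner x x"
    by (simp add: inner_ell2_def infsum_nonneg)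
  show "inner x x = 0 \<longleftrightarrow> x = 0"
  proof
    assume *: "inner x x = 0"
    have "inner (coord x i) (coord x i) = 0" for i
      by (rule nonneg_infsum_le_0D [of _ UNIV])
        (use * summable_inner_coord [of x x] in \<open>simp_all add: inner_ell2_def\<close>)
    then show "x = 0"
      by (intro ell2_eqI) (simp add: zero_ell2.rep_eq)
  qed (simp add: inner_ell2_def zero_ell2.rep_eq)
qed (simp_all add: norm_ell2_def sgn_ell2_def dist_ell2_def uniformity_ell2_def open_ell2_def)

end

instantiation ell2 :: (type, complex_inner) complex_inner
begin

lift_definition scaleC_ell2 :: "complex \<Rightarrow> ('a, 'b) ell2 \<Rightarrow> ('a, 'b) ell2"
  is "\<lambda>a f i. a *\<^sub>C f i"
  by (simp add: norm_scaleC power_mult_distrib summable_on_cmult_right)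

definition cinner_ell2 :: "('a, 'b) ell2 \<Rightarrow> ('a, 'b) ell2 \<Rightarrow> complex" where
  "cinner_ell2 x y = (\<Sum>\<^sub>\<infinity>i. cinner (coord x i) (coord y i))"

instance
proof
  fix x y z :: "('a, 'b) ell2" and a b :: complex and r :: real
  show "a *\<^sub>C (x + y) = a *\<^sub>C x + a *\<^sub>C y"
    by (transfer, simp add: scaleC_add_right)
  show "(a + b) *\<^sub>C x = a *\<^sub>C x + b *\<^sub>C x"
    by (transfer, simp add: scaleC_add_left)
  show "a *\<^sub>C b *\<^sub>C x = (a * b) *\<^sub>C x"
    by (transfer, simp add: scaleC_scaleC)
  show "1 *\<^sub>C x = x"
    by (transfer, simp)
  show "r *\<^sub>R x = complex_of_real r *\<^sub>C x"
    by (transfer, simp add: scaleR_scaleC)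
  show "cinner x y = cnj (cinner y x)"
    unfolding cinner_ell2_def infsum_cnj [symmetric] by (rule infsum_cong) (rule cinner_commute)
  show "cinner (x + y) z = cinner x z + cinner y z"
    by (simp add: cinner_ell2_def plus_ell2.rep_eq cinner_add_left infsum_add summable_cinner_coord)
  show "cinner (a *\<^sub>C x) y = cnj a * cinner x y"
    by (simp add: cinner_ell2_def scaleC_ell2.rep_eq cinner_scaleC_left infsum_cmult_right
        summable_cinner_coord)
  show "Re (cinner x y) = inner x y"
    using infsum_Re [OF summable_cinner_coord [of x y]]
    by (simp add: cinner_ell2_def inner_ell2_def Re_cinner)
qed

end

lemma norm_ell2_square: "(norm x)\<^sup>2 = (\<Sum>\<^sub>\<infinity>i. (norm (coord x i))\<^sup>2)"
  by (simp add: power2_norm_eq_inner inner_ell2_def)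

lemma sum_coord_le: "finite F \<Longrightarrow> (\<Sum>i\<in>F. (norm (coord x i))\<^sup>2) \<le> (norm x)\<^sup>2"
  unfolding norm_ell2_square by (rule finite_sum_le_infsum) (auto simp: summable_coord)

lemma norm_coord_le: "norm (coord x i) \<le> norm x"
  by (rule power2_le_imp_le) (use sum_coord_le [of "{i}" x] in simp_all)

instance ell2 :: (type, chilbert_space) chilbert_space
proof
  fix X :: "nat \<Rightarrow> ('a, 'b) ell2"
  assume X: "Cauchy X"
  have "Cauchy (\<lambda>n. coord (X n) i)" for i
  proof (rule metric_CauchyI)
    fix e :: real assume "e > 0"
    then obtain M where M: "\<And>m n. m \<ge> M \<Longrightarrow> n \<ge> M \<Longrightarrow> dist (X m) (X n) < e"
      using metric_CauchyD [OF X \<open>e > 0\<close>] by blast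
    have "dist (coord (X m) i) (coord (X n) i) \<le> dist (X m) (X n)" for m n
      using norm_coord_le [of "X m - X n" i] by (simp add: dist_norm minus_ell2.rep_eq)
    then show "\<exists>M. \<forall>m\<ge>M. \<forall>n\<ge>M. dist (coord (X m) i) (coord (X n) i) < e"
      using M by (blast intro: le_less_trans)
  qed
  then obtain f where f: "\<And>i. (\<lambda>n. coord (X n) i) \<longlonglongrightarrow> f i"
    unfolding Cauchy_convergent_iff convergent_def by metis
  have tail: "\<exists>M. \<forall>n\<ge>M. \<forall>F. finite F \<longrightarrow> (\<Sum>i\<in>F. (norm (coord (X n) i - f i))\<^sup>2) \<le> e\<^sup>2"
    if "e > 0" for e :: real
  proof -
    obtain M where M: "\<And>m n. m \<ge> M \<Longrightarrow> n \<ge> M \<Longrightarrow> dist (X m) (X n) < e"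
      using metric_CauchyD [OF X \<open>e > 0\<close>] by blast
    have "(\<Sum>i\<in>F. (norm (coord (X n) i - f i))\<^sup>2) \<le> e\<^sup>2" if "n \<ge> M" "finite F" for n F
    proof (rule tendsto_upperbound)
      show "(\<lambda>m. \<Sum>i\<in>F. (norm (coord (X n) i - coord (X m) i))\<^sup>2)
          \<longlonglongrightarrow> (\<Sum>i\<in>F. (norm (coord (X n) i - f i))\<^sup>2)"
        by (intro tendsto_intros f)
      have "(\<Sum>i\<in>F. (norm (coord (X n) i - coord (X m) i))\<^sup>2) \<le> e\<^sup>2" if "m \<ge> M" for m
      proof -
        have "(\<Sum>i\<in>F. (norm (coord (X n - X m) i))\<^sup>2) \<le> (norm (X n - X m))\<^sup>2"
          by (rule sum_coord_le) fact
        also have "\<dots> \<le> e\<^sup>2"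
          using M [OF \<open>n \<ge> M\<close> that] by (intro power_mono) (auto simp: dist_norm)
        finally show ?thesis
          by (simp add: minus_ell2.rep_eq)
      qed
      then show "\<forall>\<^sub>F m in sequentially. (\<Sum>i\<in>F. (norm (coord (X n) i - coord (X m) i))\<^sup>2) \<le> e\<^sup>2"
        by (auto simp: eventually_sequentially)
    qed simp
    then show ?thesis by blast
  qed
  have summable_diff: "(\<lambda>i. (norm (coord (X n) i - f i))\<^sup>2) summable_on UNIV"
    if "\<forall>F. finite F \<longrightarrow> (\<Sum>i\<in>F. (norm (coord (X n) i - f i))\<^sup>2) \<le> e\<^sup>2" for n and e :: real
    using that by (intro nonneg_bdd_above_summable_on) (auto intro!: bdd_aboveI)
  obtain n0 where "\<forall>F. finite F \<longrightarrow> (\<Sum>i\<in>F. (norm (coord (X n0) i - f i))\<^sup>2) \<le> 1\<^sup>2"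
    using tail [of 1] by auto
  then have "(\<lambda>i. (norm (- (coord (X n0) i - f i)))\<^sup>2) summable_on UNIV"
    unfolding norm_minus_cancel by (rule summable_diff)
  from square_summable_add [OF summable_coord [of "X n0"] this]
  have sf: "(\<lambda>i. (norm (f i))\<^sup>2) summable_on UNIV"
    by simp
  define x where "x = Abs_ell2 f"
  have x: "coord x = f"
    using sf by (simp add: x_def Abs_ell2_inverse)
  have "X \<longlonglongrightarrow> x"
  proof (rule LIMSEQ_I)
    fix r :: real assume r: "r > 0"
    obtain M where M: "\<And>n F. n \<ge> M \<Longrightarrow> finite F \<Longrightarrow>
        (\<Sum>i\<in>F. (norm (coord (X n) i - f i))\<^sup>2) \<le> (r / 2)\<^sup>2"
      using tail [of "r / 2"] r by auto
    have "norm (X n - x) < r" if "n \<ge> M" for n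
    proof -
      have "(norm (X n - x))\<^sup>2 \<le> (r / 2)\<^sup>2"
        unfolding norm_ell2_square minus_ell2.rep_eq x
        using M [OF that] by (intro infsum_le_finite_sums summable_diff) auto
      then have "norm (X n - x) \<le> r / 2"
        by (rule power2_le_imp_le) (use r in simp)
      then show ?thesis using r by simp
    qed
    then show "\<exists>no. \<forall>n\<ge>no. norm (X n - x) < r" by blast
  qed
  then show "convergent X" by (auto simp: convergent_def)
qed


section \<open>Subspaces and operators\<close>

definition bounded_clinear :: "('a :: complex_inner \<Rightarrow> 'b :: complex_inner) \<Rightarrow> bool" where
  "bounded_clinear T \<longleftrightarrow> bounded_linear T \<and> (\<forall>c x. T (c *\<^sub>C x) = c *\<^sub>C T x)"

definition orth_compl_in :: "'a :: complex_inner set \<Rightarrow> 'a set \<Rightarrow> 'a set" where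
  "orth_compl_in X S = {x \<in> X. \<forall>s\<in>S. cinner s x = 0}"

definition proj :: "'a :: chilbert_space set \<Rightarrow> 'a \<Rightarrow> 'a" where
  "proj N x = (THE y. y \<in> N \<and> x - y \<in> orth_compl_in UNIV N)"

text \<open>
  An operator on a closed subspace \<open>X\<close> is represented by a function on the ambient space, of which
  only the values on \<open>X\<close> matter.  In the following definition the adjoint is taken within \<open>X\<close>.
\<close>

definition adjoint_on :: "'a :: chilbert_space set \<Rightarrow> ('a \<Rightarrow> 'a) \<Rightarrow> 'a \<Rightarrow> 'a" where
  "adjoint_on X T x = (THE y. y \<in> X \<and> (\<forall>z\<in>X. cinner (T z) x = cinner z y))"

definition co_invariant_on :: "'a :: chilbert_space set \<Rightarrow> ('a \<Rightarrow> 'a) set \<Rightarrow> 'a set \<Rightarrow> bool" where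
  "co_invariant_on X Ts M \<longleftrightarrow> (\<forall>T\<in>Ts. adjoint_on X T ` M \<subseteq> M)"

definition unital_algebra :: "('a :: complex_inner \<Rightarrow> 'a) set \<Rightarrow> bool" where
  "unital_algebra \<A> \<longleftrightarrow> id \<in> \<A> \<and>
     (\<forall>S\<in>\<A>. \<forall>T\<in>\<A>. (\<lambda>x. S x + T x) \<in> \<A> \<and> S \<circ> T \<in> \<A>) \<and>
     (\<forall>c. \<forall>T\<in>\<A>. (\<lambda>x. c *\<^sub>C T x) \<in> \<A>)"

definition cyclic_on :: "'a :: chilbert_space set \<Rightarrow> ('a \<Rightarrow> 'a) set \<Rightarrow> 'a set \<Rightarrow> bool" where
  "cyclic_on X Ts M \<longleftrightarrow>
     closure (cspan {T h | T h. T \<in> unital_algebra hull Ts \<and> h \<in> M}) = X"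

text \<open>
  The weak operator topology, on the set of bounded operators: the initial topology for the maps
  \<open>T \<mapsto> \<langle>x, T y\<rangle>\<close> (the function space carries the product topology).
\<close>

definition wot :: "('a :: chilbert_space \<Rightarrow> 'a) topology" where
  "wot = pullback_topology {T. bounded_clinear T} (\<lambda>T (x, y). cinner x (T y)) euclidean"

definition two_sided_ideal ::
    "('a :: chilbert_space \<Rightarrow> 'a) set \<Rightarrow> ('a \<Rightarrow> 'a) set \<Rightarrow> bool" where
  "two_sided_ideal \<A> J \<longleftrightarrow> J \<subseteq> \<A> \<and> (\<lambda>x. 0) \<in> J \<and>
     (\<forall>S\<in>J. \<forall>T\<in>J. (\<lambda>x. S x + T x) \<in> J) \<and>
     (\<forall>c. \<forall>T\<in>J. (\<lambda>x. c *\<^sub>C T x) \<in> J) \<and>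
     (\<forall>A\<in>\<A>. \<forall>T\<in>J. A \<circ> T \<in> J \<and> T \<circ> A \<in> J)"


section \<open>The full Fock space\<close>

text \<open>
  With \<open>n = CARD('n)\<close>, the vectors \<open>e\<^sub>w = e\<^bsub>i1\<^esub> \<otimes> \<dots> \<otimes> e\<^bsub>ik\<^esub>\<close>, \<open>w = [i1, \<dots>, ik]\<close>, form an orthonormal
  basis of the \<open>k\<close>-th tensor power of \<open>H\<^sub>n\<close>.  So the full Fock space is the space of square summable
  families indexed by words; \<open>coord \<phi> w\<close> is the coefficient of \<open>\<phi>\<close> at \<open>e\<^sub>w\<close>, and the empty word
  belongs to the summand \<open>\<complex>1\<close>.
\<close>

type_synonym 'n fock = "('n list, complex) ell2"

lift_definition vacuum :: "'n fock" is "\<lambda>w. if w = [] then 1 else 0"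
proof -
  have "(\<lambda>w :: 'n list. (cmod (if w = [] then 1 else 0))\<^sup>2) summable_on UNIV \<longleftrightarrow>
      (\<lambda>w :: 'n list. (cmod (if w = [] then 1 else 0))\<^sup>2) summable_on {[]}"
    by (rule summable_on_cong_neutral) auto
  then show "(\<lambda>w :: 'n list. (cmod (if w = [] then 1 else 0))\<^sup>2) summable_on UNIV"
    by simp
qed

text \<open>The left creation operators, determined by \<open>e\<^sub>i \<otimes> e\<^sub>w = e\<^bsub>i#w\<^esub>\<close>.\<close>

lift_definition creation :: "'n \<Rightarrow> 'n fock \<Rightarrow> 'n fock"
  is "\<lambda>i f w. case w of [] \<Rightarrow> 0 | j # v \<Rightarrow> if j = i then f v else 0"
proof -
  fix i :: 'n and f :: "'n list \<Rightarrow> complex"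
  let ?g = "\<lambda>w. case w of [] \<Rightarrow> 0 | j # v \<Rightarrow> if j = i then f v else 0"
  assume "(\<lambda>w. (cmod (f w))\<^sup>2) summable_on UNIV"
  then have "((\<lambda>w. (cmod (?g w))\<^sup>2) \<circ> (#) i) summable_on UNIV"
    by (simp add: o_def)
  then have "(\<lambda>w. (cmod (?g w))\<^sup>2) summable_on range ((#) i)"
    by (subst summable_on_reindex) (auto simp: inj_on_def)
  moreover have "(\<lambda>w. (cmod (?g w))\<^sup>2) summable_on UNIV \<longleftrightarrow>
      (\<lambda>w. (cmod (?g w))\<^sup>2) summable_on range ((#) i)"
    by (rule summable_on_cong_neutral) (auto split: list.splits)
  ultimately show "(\<lambda>w. (cmod (?g w))\<^sup>2) summable_on UNIV"
    by simp
qed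

definition F_infty :: "('n :: finite fock \<Rightarrow> 'n fock) set" where
  "F_infty = (\<lambda>\<A>. unital_algebra \<A> \<and> closedin wot \<A>) hull (range creation)"

definition N_space :: "('n :: finite fock \<Rightarrow> 'n fock) set \<Rightarrow> 'n fock set" where
  "N_space J = orth_compl_in UNIV (closure (cspan {T \<phi> | T \<phi>. T \<in> J}))"

text \<open>The operator \<open>B\<^sub>i\<close> is the restriction of the following function to \<open>N_space J\<close>.\<close>

definition B_op :: "('n :: finite fock \<Rightarrow> 'n fock) set \<Rightarrow> 'n \<Rightarrow> 'n fock \<Rightarrow> 'n fock" where
  "B_op J i = proj (N_space J) \<circ> creation i"


section \<open>Hilbert space tensor products with a Hilbert space\<close>

text \<open>
  The tensor product of the scalar sequence space over an index set with a Hilbert space \<open>'d\<close> is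
  the space of square summable \<open>'d\<close>-valued families over the same index set.
\<close>

lift_definition tensor ::
    "('i, complex) ell2 \<Rightarrow> 'd :: complex_inner \<Rightarrow> ('i, 'd) ell2" (infixr "\<otimes>\<^sub>h" 70)
  is "\<lambda>f d i. f i *\<^sub>C d"
  by (simp add: norm_scaleC power_mult_distrib summable_on_cmult_left)

lemma cinner_tensor: "cinner (\<phi> \<otimes>\<^sub>h d) (\<psi> \<otimes>\<^sub>h d') = cinner \<phi> \<psi> * cinner d d'"
proof -
  have "cinner (\<phi> \<otimes>\<^sub>h d) (\<psi> \<otimes>\<^sub>h d') = (\<Sum>\<^sub>\<infinity>i. cinner (coord \<phi> i) (coord \<psi> i) * cinner d d')"
    by (simp add: cinner_ell2_def [of "\<phi> \<otimes>\<^sub>h d"] tensor.rep_eq cinner_scaleC_left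
        cinner_scaleC_right cinner_complex_def mult_ac)
  also have "\<dots> = cinner \<phi> \<psi> * cinner d d'"
    by (simp add: cinner_ell2_def [of \<phi>] infsum_cmult_left summable_cinner_coord)
  finally show ?thesis .
qed

definition tensor_space :: "('i, complex) ell2 set \<Rightarrow> ('i, 'd :: chilbert_space) ell2 set" where
  "tensor_space N = closure (cspan {\<phi> \<otimes>\<^sub>h d | \<phi> d. \<phi> \<in> N})"

text \<open>
  \<open>ampliation T\<close> is \<open>T \<otimes> I\<close> for a bounded operator \<open>T\<close>.  It exists, and it is unique since the
  elementary tensors span a dense subspace.
\<close>

definition ampliation ::
    "(('i, complex) ell2 \<Rightarrow> ('i, complex) ell2) \<Rightarrow> ('i, 'd :: chilbert_space) ell2 \<Rightarrow> ('i, 'd) ell2"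
  where "ampliation T =
    (THE A. bounded_clinear A \<and> (\<forall>\<phi> d. A (\<phi> \<otimes>\<^sub>h d) = T \<phi> \<otimes>\<^sub>h d))"

end

theory Submission
  imports Defs
begin

text \<open>
  Since \<open>J\<close> is a left ideal, \<open>\<N>\<^sub>J\<close> is invariant under every \<open>S\<^sub>i\<^sup>*\<close>; hence \<open>B\<^sub>i\<^sup>* = S\<^sub>i\<^sup>*|\<N>\<^sub>J\<close>, and
  compressing \<open>I - \<Sum> S\<^sub>i S\<^sub>i\<^sup>* = P\<^sub>\<complex>\<close> to \<open>\<N>\<^sub>J \<ni> 1\<close> gives
  \<open>P\<^sub>0 = I - \<Sum> (B\<^sub>i \<otimes> I)(B\<^sub>i \<otimes> I)\<^sup>*\<close>.  By co-invariance, the closed invariant subspace generated by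
  \<open>M\<close> contains \<open>P\<^sub>0 M\<close>.  If \<open>P\<^sub>0 M\<close> is dense in \<open>1 \<otimes> D\<close>, it therefore contains all
  \<open>B\<^sub>w 1 \<otimes> d = P e\<^sub>w \<otimes> d\<close>, which span a dense subspace.  Conversely, \<open>1 \<otimes> d\<close> is orthogonal to the
  ranges of all \<open>B\<^sub>i \<otimes> I\<close>, so a vector \<open>1 \<otimes> d\<close> orthogonal to \<open>M\<close> is orthogonal to the
  invariant subspace generated by \<open>M\<close>.
\<close>


section \<open>Orthogonality and projections\<close>

lemma cinner_zero_right [simp]: "cinner x (0 :: 'a :: complex_inner) = 0"
  using cinner_add_right [of x 0 0] by simp

lemma cinner_zero_left [simp]: "cinner 0 (x :: 'a :: complex_inner) = 0"
  using cinner_add_left [of 0 0 x] by simp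

lemma cinner_minus_right: "cinner x (- y) = - cinner x (y :: 'a :: complex_inner)"
  using cinner_add_right [of x y "- y"] by (simp add: eq_neg_iff_add_eq_0 add.commute)

lemma cinner_diff_right: "cinner x (y - z) = cinner x y - cinner x (z :: 'a :: complex_inner)"
  using cinner_add_right [of x y "- z"] by (simp add: cinner_minus_right)

lemma cinner_diff_left: "cinner (x - y) z = cinner x z - cinner y (z :: 'a :: complex_inner)"
  by (metis cinner_diff_right cinner_commute complex_cnj_diff)

lemma cinner_eq_0_commute: "cinner x y = 0 \<longleftrightarrow> cinner y (x :: 'a :: complex_inner) = 0"
  by (metis cinner_commute complex_cnj_zero)

lemma cinner_self_eq_0: "cinner x x = 0 \<longleftrightarrow> x = (0 :: 'a :: complex_inner)"
  by (metis Re_cinner cinner_zero_right inner_eq_zero_iff zero_complex.sel(1))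

lemma bounded_linear_scaleC: "bounded_linear (\<lambda>x :: 'a :: complex_inner. c *\<^sub>C x)"
proof (rule bounded_linear_intro)
  show "c *\<^sub>C (r *\<^sub>R x) = r *\<^sub>R (c *\<^sub>C x)" for r and x :: 'a
    by (simp add: scaleR_scaleC scaleC_scaleC mult.commute)
  show "norm (c *\<^sub>C x) \<le> norm x * cmod c" for x :: 'a
    by (simp add: norm_scaleC)
qed (rule scaleC_add_right)

lemma bounded_linear_cinner: "bounded_linear (\<lambda>y :: 'a :: complex_inner. cinner x y)"
proof -
  have "cinner x y = complex_of_real (inner x y) + \<i> * complex_of_real (inner (\<i> *\<^sub>C x) y)" for y
    by (simp add: complex_eq_iff Re_cinner Im_cinner)
  then show ?thesis
    by (auto intro!: bounded_linear_add bounded_linear_const_mult bounded_linear_of_real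
        bounded_linear_inner_right bounded_linear_compose [OF bounded_linear_of_real])
qed

text \<open>Together with \<open>closure_cspan_minimal\<close> this carries all density arguments
  below: an inclusion of a closed span into a preimage of \<open>S\<close> under \<open>T\<close>
  has to be tested on the spanning vectors only.\<close>

lemma bounded_clinear_vimage:
  assumes T: "bounded_clinear T" and S: "csubspace S" "closed S"
  shows "csubspace {x. T x \<in> S}" "closed {x. T x \<in> S}"
proof -
  interpret T: bounded_linear T
    using T by (simp add: bounded_clinear_def)
  show "csubspace {x. T x \<in> S}"
    using T S(1) unfolding complex_vector.subspace_def
    by (auto simp: bounded_clinear_def T.add T.zero)
  show "closed {x. T x \<in> S}"
    using continuous_closed_vimage [OF S(2), of T] T.isCont [OF continuous_ident]
    by (simp add: vimage_def)
qed

lemma bounded_clinear_cinner: "bounded_clinear (cinner x)"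
  by (simp add: bounded_clinear_def bounded_linear_cinner cinner_scaleC_right scaleC_complex_def)

lemma csubspace_orth: "csubspace {y. cinner x y = 0}"
  and closed_orth: "closed {y. cinner x (y :: 'a :: complex_inner) = 0}"
  using bounded_clinear_vimage [OF bounded_clinear_cinner, of "{0}" x] by simp_all

lemma csubspace_closure:
  assumes S: "csubspace (S :: 'a :: complex_inner set)"
  shows "csubspace (closure S)"
  unfolding complex_vector.subspace_def
proof (intro conjI allI ballI)
  show "0 \<in> closure S"
    using S closure_subset complex_vector.subspace_0 by blast
next
  fix x y assume "x \<in> closure S" "y \<in> closure S"
  then obtain f g where "\<forall>n. f n \<in> S" "f \<longlonglongrightarrow> x" "\<forall>n. g n \<in> S" "g \<longlonglongrightarrow> y"
    unfolding closure_sequential by blast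
  then have "\<forall>n. f n + g n \<in> S" "(\<lambda>n. f n + g n) \<longlonglongrightarrow> x + y"
    using S by (auto intro: tendsto_add complex_vector.subspace_add)
  then show "x + y \<in> closure S"
    unfolding closure_sequential by (intro exI [of _ "\<lambda>n. f n + g n"] conjI)
next
  fix c x assume "x \<in> closure S"
  then obtain f where f: "\<forall>n. f n \<in> S" "f \<longlonglongrightarrow> x"
    unfolding closure_sequential by blast
  then have "\<forall>n. c *\<^sub>C f n \<in> S" "(\<lambda>n. c *\<^sub>C f n) \<longlonglongrightarrow> c *\<^sub>C x"
    using S complex_vector.subspace_scale bounded_linear.tendsto [OF bounded_linear_scaleC]
    by blast+
  then show "c *\<^sub>C x \<in> closure S"
    unfolding closure_sequential by (intro exI [of _ "\<lambda>n. c *\<^sub>C f n"] conjI)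
qed

lemma closure_cspan_minimal:
  "A \<subseteq> S \<Longrightarrow> csubspace S \<Longrightarrow> closed S \<Longrightarrow> closure (cspan A) \<subseteq> S"
  by (simp add: closure_minimal complex_vector.span_minimal)

lemma subset_closure_cspan: "A \<subseteq> closure (cspan A)"
  using complex_vector.span_superset closure_subset by blast

lemma csubspace_closure_cspan: "csubspace (closure (cspan A))"
  by (simp add: csubspace_closure complex_vector.subspace_span)

text \<open>For fixed \<open>x\<close>, the vectors orthogonal to \<open>x\<close> form a closed
  subspace, so orthogonality to \<open>A\<close> passes to its closed span.\<close>

lemma orth_compl_in_closure_cspan: "orth_compl_in X (closure (cspan A)) = orth_compl_in X A"
proof
  show "orth_compl_in X (closure (cspan A)) \<subseteq> orth_compl_in X A"
    using subset_closure_cspan [of A] by (auto simp: orth_compl_in_def)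
  show "orth_compl_in X A \<subseteq> orth_compl_in X (closure (cspan A))"
  proof
    fix x assume x: "x \<in> orth_compl_in X A"
    have "closure (cspan A) \<subseteq> {y. cinner x y = 0}"
      using x by (intro closure_cspan_minimal csubspace_orth closed_orth)
        (auto simp: orth_compl_in_def cinner_eq_0_commute [of x])
    then show "x \<in> orth_compl_in X (closure (cspan A))"
      using x by (auto simp: orth_compl_in_def cinner_eq_0_commute [of _ x])
  qed
qed

lemma csubspace_orth_compl: "csubspace (orth_compl_in UNIV A)"
  by (auto simp: complex_vector.subspace_def orth_compl_in_def cinner_add_right cinner_scaleC_right)

lemma closed_orth_compl: "closed (orth_compl_in UNIV A)"
proof -
  have "orth_compl_in UNIV A = (\<Inter>s\<in>A. {y. cinner s y = 0})"
    by (auto simp: orth_compl_in_def)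
  then show ?thesis
    by (auto intro: closed_orth)
qed

section \<open>Nearest points and the orthogonal decomposition\<close>

lemma parallelogram_law:
  "(norm (x + y))\<^sup>2 + (norm (x - y))\<^sup>2 = 2 * (norm x)\<^sup>2 + 2 * (norm (y :: 'a :: real_inner))\<^sup>2"
  by (simp add: power2_norm_eq_inner inner_add_left inner_add_right inner_diff_left
      inner_diff_right)

text \<open>A minimising sequence for the distance to \<open>x\<close> is Cauchy by the
  parallelogram law; its limit stays in the closed set \<open>S\<close> and attains the
  infimum.\<close>

lemma nearest_point_exists:
  fixes S :: "'a :: {real_inner, complete_space} set"
  assumes "closed S" "convex S" "S \<noteq> {}"
  shows "\<exists>y\<in>S. \<forall>s\<in>S. norm (x - y) \<le> norm (x - s)"
proof -
  define d where "d = (INF s\<in>S. norm (x - s))"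
  have d_le: "d \<le> norm (x - s)" if "s \<in> S" for s
    unfolding d_def using that by (intro cINF_lower bdd_belowI [of _ 0]) auto
  have d0: "0 \<le> d"
    unfolding d_def using assms by (intro cINF_greatest) auto
  have "\<exists>s\<in>S. norm (x - s) < d + inverse (real (Suc n))" for n
  proof (rule ccontr)
    assume "\<not> ?thesis"
    then have "d + inverse (real (Suc n)) \<le> d"
      unfolding d_def using assms by (intro cINF_greatest) (auto simp: not_less)
    then show False
      by (simp add: not_le)
  qed
  then obtain f where f: "\<And>n. f n \<in> S" "\<And>n. norm (x - f n) < d + inverse (real (Suc n))"
    by metis
  have lim: "(\<lambda>n. norm (x - f n)) \<longlonglongrightarrow> d"
  proof (rule tendsto_sandwich)
    show "\<forall>\<^sub>F n in sequentially. d \<le> norm (x - f n)"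
      by (intro always_eventually allI d_le f)
    show "\<forall>\<^sub>F n in sequentially. norm (x - f n) \<le> d + inverse (real (Suc n))"
      by (intro always_eventually allI less_imp_le f)
    show "(\<lambda>n. d + inverse (real (Suc n))) \<longlonglongrightarrow> d"
      using tendsto_add [OF tendsto_const [of d] LIMSEQ_inverse_real_of_nat]
      unfolding add_0_right .
  qed (rule tendsto_const)
  \<comment> \<open>Convexity puts the midpoint of \<open>f m\<close> and \<open>f n\<close> into
    \<open>S\<close>, so its distance from \<open>x\<close> is at least \<open>d\<close>. Inserting
    this into the parallelogram law for \<open>x - f m\<close> and \<open>x - f n\<close> bounds
    their difference.\<close>
  have diff: "(norm (f m - f n))\<^sup>2 \<le> 2 * ((norm (x - f m))\<^sup>2 - d\<^sup>2) + 2 * ((norm (x - f n))\<^sup>2 - d\<^sup>2)"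
    for m n
  proof -
    have "(1/2) *\<^sub>R f m + (1/2) *\<^sub>R f n \<in> S"
      using convexD [OF \<open>convex S\<close>, of "f m" "f n" "1/2" "1/2"] f by simp
    then have "d \<le> norm (x - ((1/2) *\<^sub>R f m + (1/2) *\<^sub>R f n))"
      by (rule d_le)
    also have "x - ((1/2) *\<^sub>R f m + (1/2) *\<^sub>R f n) = (1/2) *\<^sub>R ((x - f m) + (x - f n))"
      by (simp add: scaleR_diff_right scaleR_add_right)
        (simp add: algebra_simps flip: scaleR_add_left)
    finally have "2 * d \<le> norm ((x - f m) + (x - f n))"
      by simp
    then have "(2 * d)\<^sup>2 \<le> (norm ((x - f m) + (x - f n)))\<^sup>2"
      using d0 by (intro power_mono) auto
    then show ?thesis
      using parallelogram_law [of "x - f m" "x - f n"]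
      by (simp add: norm_minus_commute [of "f m"] power_mult_distrib)
  qed
  have "Cauchy f"
  proof (rule metric_CauchyI)
    fix e :: real assume e: "e > 0"
    have "(\<lambda>n. (norm (x - f n))\<^sup>2 - d\<^sup>2) \<longlonglongrightarrow> d\<^sup>2 - d\<^sup>2"
      by (intro tendsto_intros lim)
    then have "\<forall>\<^sub>F n in sequentially. (norm (x - f n))\<^sup>2 - d\<^sup>2 < e\<^sup>2 / 4"
      using e by (intro order_tendstoD(2)) auto
    then obtain k where k: "\<And>n. n \<ge> k \<Longrightarrow> (norm (x - f n))\<^sup>2 - d\<^sup>2 < e\<^sup>2 / 4"
      by (auto simp: eventually_sequentially)
    have "dist (f m) (f n) < e" if "m \<ge> k" "n \<ge> k" for m n
    proof -
      have "(norm (f m - f n))\<^sup>2 < e\<^sup>2"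
        using diff [of m n] k [OF that(1)] k [OF that(2)] by argo
      then show ?thesis
        using e by (simp add: dist_norm power_less_imp_less_base)
    qed
    then show "\<exists>k. \<forall>m\<ge>k. \<forall>n\<ge>k. dist (f m) (f n) < e"
      by blast
  qed
  then obtain y where y: "f \<longlonglongrightarrow> y"
    using Cauchy_convergent convergent_def by blast
  have "y \<in> S"
    using closed_sequentially [OF \<open>closed S\<close>] f(1) y by blast
  moreover have "norm (x - y) = d"
    using LIMSEQ_unique [OF tendsto_norm [OF tendsto_diff [OF tendsto_const y]] lim] .
  ultimately show ?thesis
    using d_le by auto
qed

lemma nearest_point_inner_eq_0:
  fixes y :: "'a :: real_inner"
  assumes min: "\<And>t. norm y \<le> norm (y - t *\<^sub>R s)"
  shows "inner s y = 0"
proof (cases "s = 0")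
  case False
  \<comment> \<open>This \<open>t\<close> minimises the quadratic polynomial
    \<open>(norm (y - t *\<^sub>R s))\<^sup>2\<close>; comparison with the value at 0 forces
    \<open>(inner s y)\<^sup>2 / inner s s\<close> to be nonpositive.\<close>
  define t where "t = inner s y / inner s s"
  have s: "inner s s > 0"
    using False by simp
  have "(norm y)\<^sup>2 \<le> (norm (y - t *\<^sub>R s))\<^sup>2"
    by (intro power_mono min norm_ge_zero)
  then have "inner y y \<le> inner y y - 2 * t * inner s y + t * t * inner s s"
    by (simp add: power2_norm_eq_inner inner_diff_left inner_diff_right inner_commute algebra_simps)
  moreover have "t * inner s s = inner s y"
    using s by (simp add: t_def)
  ultimately have "t * inner s y \<le> 0"
    by (simp add: mult.assoc)
  then have "(inner s y)\<^sup>2 / inner s s \<le> 0"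
    by (simp add: t_def power2_eq_square)
  then show ?thesis
    using s by (simp add: divide_le_0_iff not_le)
qed simp

lemma orthogonal_decomposition_exists:
  fixes N :: "'a :: chilbert_space set"
  assumes N: "csubspace N" "closed N"
  shows "\<exists>y. y \<in> N \<and> x - y \<in> orth_compl_in UNIV N"
proof -
  have "convex N"
    using N(1) by (auto simp: convex_def scaleR_scaleC complex_vector.subspace_add
        complex_vector.subspace_scale)
  then obtain y where y: "y \<in> N" "\<And>s. s \<in> N \<Longrightarrow> norm (x - y) \<le> norm (x - s)"
    using nearest_point_exists [OF N(2), of x] complex_vector.subspace_0 [OF N(1)] by auto
  have orth: "inner s (x - y) = 0" if "s \<in> N" for s
  proof (rule nearest_point_inner_eq_0)
    fix t :: real
    have "y + t *\<^sub>R s \<in> N"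
      using y(1) that N(1)
      by (simp add: scaleR_scaleC complex_vector.subspace_add complex_vector.subspace_scale)
    from y(2) [OF this] show "norm (x - y) \<le> norm (x - y - t *\<^sub>R s)"
      by (simp add: algebra_simps)
  qed
  \<comment> \<open>Minimality yields only real orthogonality. Applied to \<open>s\<close> it kills
    the real part, applied to \<open>\<i> *\<^sub>C s\<close> the imaginary part.\<close>
  have "cinner s (x - y) = 0" if "s \<in> N" for s
    using orth [OF that] orth [of "\<i> *\<^sub>C s"] that N(1)
    by (simp add: complex_eq_iff Re_cinner Im_cinner complex_vector.subspace_scale)
  with y(1) show ?thesis
    by (auto simp: orth_compl_in_def)
qed

section \<open>Calculus of orthogonal projections\<close>

text \<open>The uniqueness behind the definite description in \<open>proj\<close>: the difference of
  two candidates lies in \<open>N\<close> and is orthogonal to \<open>N\<close>, hence to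
  itself.\<close>

lemma proj_eqI:
  assumes N: "csubspace N" and y: "y \<in> N" "\<And>s. s \<in> N \<Longrightarrow> cinner s (x - y) = 0"
  shows "proj N x = y"
  unfolding proj_def
proof (rule the_equality)
  show "y \<in> N \<and> x - y \<in> orth_compl_in UNIV N"
    using y by (auto simp: orth_compl_in_def)
next
  fix z assume z: "z \<in> N \<and> x - z \<in> orth_compl_in UNIV N"
  then have "z - y \<in> N"
    using N y complex_vector.subspace_diff by blast
  then have "cinner (z - y) (x - y) = 0" "cinner (z - y) (x - z) = 0"
    using z y by (auto simp: orth_compl_in_def)
  then have "cinner (z - y) ((x - y) - (x - z)) = 0"
    unfolding cinner_diff_right [of "z - y" "x - y"] by simp
  then show "z = y"
    by (simp add: cinner_self_eq_0)
qed

lemma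
  fixes N :: "'a :: chilbert_space set"
  assumes N: "csubspace N" "closed N"
  shows proj_in: "proj N x \<in> N"
    and cinner_diff_proj: "s \<in> N \<Longrightarrow> cinner s (x - proj N x) = 0"
proof -
  obtain y where y: "y \<in> N" "x - y \<in> orth_compl_in UNIV N"
    using orthogonal_decomposition_exists [OF N] by blast
  then have "proj N x = y"
    by (intro proj_eqI N) (auto simp: orth_compl_in_def)
  with y show "proj N x \<in> N" "s \<in> N \<Longrightarrow> cinner s (x - proj N x) = 0"
    by (auto simp: orth_compl_in_def)
qed

lemma proj_ident: "csubspace N \<Longrightarrow> x \<in> N \<Longrightarrow> proj N x = x"
  by (rule proj_eqI) auto

lemma cinner_proj_right:
  "csubspace N \<Longrightarrow> closed N \<Longrightarrow> s \<in> N \<Longrightarrow> cinner s (proj N x) = cinner s x"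
  using cinner_diff_proj [of N s x] by (simp add: cinner_diff_right)

lemma cinner_proj_left:
  "csubspace N \<Longrightarrow> closed N \<Longrightarrow> s \<in> N \<Longrightarrow> cinner (proj N x) s = cinner x s"
  by (metis cinner_commute cinner_proj_right)

text \<open>Linearity follows from uniqueness of the decomposition; contractivity follows by
  Cauchy-Schwarz, since the squared norm of the projected vector is its inner product with
  \<open>x\<close>.\<close>

lemma bounded_clinear_proj:
  fixes N :: "'a :: chilbert_space set"
  assumes N: "csubspace N" "closed N"
  shows "bounded_clinear (proj N)"
proof -
  note [simp] = N proj_in cinner_proj_right cinner_diff_right cinner_add_right cinner_scaleC_right
  have add: "proj N (x + y) = proj N x + proj N y" for x y
    by (rule proj_eqI) (simp_all add: complex_vector.subspace_add)
  have scale: "proj N (c *\<^sub>C x) = c *\<^sub>C proj N x" for c x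
    by (rule proj_eqI) (simp_all add: complex_vector.subspace_scale)
  have "norm (proj N x) \<le> norm x * 1" for x
  proof -
    have "(norm (proj N x))\<^sup>2 = inner (proj N x) x"
      by (simp add: power2_norm_eq_inner flip: Re_cinner)
    also have "\<dots> \<le> norm (proj N x) * norm x"
      by (rule norm_cauchy_schwarz)
    finally show ?thesis
      by (cases "norm (proj N x) = 0") (auto simp: power2_eq_square)
  qed
  then have "bounded_linear (proj N)"
    by (intro bounded_linear_intro [of _ 1]) (simp_all add: add scale scaleR_scaleC)
  then show ?thesis
    by (simp add: bounded_clinear_def scale)
qed

lemma bounded_clinear_comp:
  "bounded_clinear S \<Longrightarrow> bounded_clinear T \<Longrightarrow> bounded_clinear (S \<circ> T)"
  by (simp add: bounded_clinear_def o_def bounded_linear_compose)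

lemma closed_csubspace_eq_UNIV:
  fixes S :: "'a :: chilbert_space set"
  assumes S: "csubspace S" "closed S" and orth: "\<And>x. (\<And>s. s \<in> S \<Longrightarrow> cinner s x = 0) \<Longrightarrow> x = 0"
  shows "S = UNIV"
proof -
  have "x = proj S x" for x
    using orth [of "x - proj S x"] cinner_diff_proj [OF S] by simp
  then show ?thesis
    using proj_in [OF S] by (metis UNIV_eq_I)
qed


section \<open>Vector-valued creation operators\<close>

text \<open>The elementary tensor of the basis vector at \<open>i\<close> with \<open>a\<close>,
  available for values in any real inner product space.\<close>

lift_definition single :: "'i \<Rightarrow> 'a :: real_inner \<Rightarrow> ('i, 'a) ell2"
  is "\<lambda>i a j. if j = i then a else 0"
proof -
  fix i :: 'i and a :: 'a
  have "(\<lambda>j. (norm (if j = i then a else 0))\<^sup>2) summable_on UNIV \<longleftrightarrow>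
      (\<lambda>j. (norm (if j = i then a else 0))\<^sup>2) summable_on {i}"
    by (rule summable_on_cong_neutral) auto
  then show "(\<lambda>j. (norm (if j = i then a else 0))\<^sup>2) summable_on UNIV"
    by simp
qed

lemma vacuum_eq: "vacuum = single [] 1"
  by (rule ell2_eqI) (simp add: vacuum.rep_eq single.rep_eq)

lemma tensor_single: "single i 1 \<otimes>\<^sub>h d = single i d"
  by (rule ell2_eqI) (simp add: tensor.rep_eq single.rep_eq)

lemma vacuum_tensor: "vacuum \<otimes>\<^sub>h d = single [] d"
  by (simp add: vacuum_eq tensor_single)

lemma cinner_single_left: "cinner (single i a) x = cinner a (coord x i)"
proof -
  have "cinner (single i a) x = (\<Sum>\<^sub>\<infinity>j\<in>{i}. cinner a (coord x j))"
    unfolding cinner_ell2_def by (rule infsum_cong_neutral) (auto simp: single.rep_eq)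
  then show ?thesis by simp
qed

text \<open>Pairing with \<open>single i a\<close> reads off the coordinate at \<open>i\<close>, so
  only 0 is orthogonal to all these vectors.\<close>

lemma closed_csubspace_singles:
  fixes S :: "('i, 'a :: chilbert_space) ell2 set"
  assumes "csubspace S" "closed S" and singles: "\<And>i a. single i a \<in> S"
  shows "S = UNIV"
proof (rule closed_csubspace_eq_UNIV)
  fix x assume x: "\<And>s. s \<in> S \<Longrightarrow> cinner s x = 0"
  have "cinner (coord x i) (coord x i) = 0" for i
    using x [OF singles, of i "coord x i"] by (simp add: cinner_single_left)
  then show "x = 0"
    by (intro ell2_eqI) (simp add: cinner_self_eq_0 zero_ell2.rep_eq)
qed fact+

text \<open>The formula of \<open>creation\<close>, but for families with values in any real inner
  product space: for values in \<open>D\<close> it is \<open>S\<^sub>i \<otimes> I\<close>, and for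
  complex values it is \<open>creation\<close> itself.\<close>

lift_definition shift :: "'n \<Rightarrow> ('n list, 'a :: real_inner) ell2 \<Rightarrow> ('n list, 'a) ell2"
  is "\<lambda>i f w. case w of [] \<Rightarrow> 0 | j # v \<Rightarrow> if j = i then f v else 0"
proof -
  fix i :: 'n and f :: "'n list \<Rightarrow> 'a"
  let ?g = "\<lambda>w. case w of [] \<Rightarrow> 0 | j # v \<Rightarrow> if j = i then f v else 0"
  assume "(\<lambda>w. (norm (f w))\<^sup>2) summable_on UNIV"
  then have "((\<lambda>w. (norm (?g w))\<^sup>2) \<circ> (#) i) summable_on UNIV"
    by (simp add: o_def)
  then have "(\<lambda>w. (norm (?g w))\<^sup>2) summable_on range ((#) i)"
    by (subst summable_on_reindex) (auto simp: inj_on_def)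
  moreover have "(\<lambda>w. (norm (?g w))\<^sup>2) summable_on UNIV \<longleftrightarrow>
      (\<lambda>w. (norm (?g w))\<^sup>2) summable_on range ((#) i)"
    by (rule summable_on_cong_neutral) (auto split: list.splits)
  ultimately show "(\<lambda>w. (norm (?g w))\<^sup>2) summable_on UNIV"
    by simp
qed

text \<open>This is the adjoint of \<open>shift i\<close>, by \<open>cinner_shift\<close>; it keeps
  the subfamily at the words beginning with \<open>i\<close>.\<close>

lift_definition backshift :: "'n \<Rightarrow> ('n list, 'a :: real_inner) ell2 \<Rightarrow> ('n list, 'a) ell2"
  is "\<lambda>i f w. f (i # w)"
proof -
  fix i :: 'n and f :: "'n list \<Rightarrow> 'a"
  assume "(\<lambda>w. (norm (f w))\<^sup>2) summable_on UNIV"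
  then have "(\<lambda>w. (norm (f w))\<^sup>2) summable_on range ((#) i)"
    by (rule summable_on_subset_banach) simp
  then show "(\<lambda>w. (norm (f (i # w)))\<^sup>2) summable_on UNIV"
    by (subst (asm) summable_on_reindex) (auto simp: inj_on_def o_def)
qed

lemma creation_eq_shift: "creation = shift"
  by (intro ext ell2_eqI) (simp add: creation.rep_eq shift.rep_eq)

lemma cinner_shift: "cinner (shift i x) y = cinner x (backshift i y)"
proof -
  have "cinner (shift i x) y = (\<Sum>\<^sub>\<infinity>w\<in>range ((#) i). cinner (coord (shift i x) w) (coord y w))"
    unfolding cinner_ell2_def
    by (rule infsum_cong_neutral) (auto simp: shift.rep_eq split: list.splits)
  also have "\<dots> = cinner x (backshift i y)"
    unfolding cinner_ell2_def
    by (subst infsum_reindex) (auto simp: inj_on_def o_def shift.rep_eq backshift.rep_eq)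
  finally show ?thesis .
qed

lemma backshift_shift: "backshift i (shift i x) = x"
  by (rule ell2_eqI) (simp add: backshift.rep_eq shift.rep_eq)

lemma norm_shift: "norm (shift i x) = norm (x :: ('n list, 'a :: complex_inner) ell2)"
  by (simp add: norm_eq_sqrt_inner cinner_shift backshift_shift flip: Re_cinner)

lemma norm_backshift_le: "norm (backshift i x) \<le> norm (x :: ('n list, 'a :: complex_inner) ell2)"
proof -
  have "(norm (backshift i x))\<^sup>2 = inner (shift i (backshift i x)) x"
    by (simp add: power2_norm_eq_inner cinner_shift flip: Re_cinner)
  also have "\<dots> \<le> norm (backshift i x) * norm x"
    using norm_cauchy_schwarz [of "shift i (backshift i x)" x] by (simp add: norm_shift)
  finally show ?thesis
    by (cases "norm (backshift i x) = 0") (auto simp: power2_eq_square)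
qed

lemma bounded_clinear_shift:
  "bounded_clinear (shift i :: ('n list, 'a :: complex_inner) ell2 \<Rightarrow> _)"
  unfolding bounded_clinear_def
proof (intro conjI allI bounded_linear_intro [of _ 1])
  fix x y :: "('n list, 'a) ell2" and r c
  show "shift i (x + y) = shift i x + shift i y" "shift i (r *\<^sub>R x) = r *\<^sub>R shift i x"
    "shift i (c *\<^sub>C x) = c *\<^sub>C shift i x"
    by (rule ell2_eqI, simp add: shift.rep_eq plus_ell2.rep_eq scaleR_ell2.rep_eq
        scaleC_ell2.rep_eq split: list.splits)+
qed (simp add: norm_shift)

lemma bounded_clinear_backshift:
  "bounded_clinear (backshift i :: ('n list, 'a :: complex_inner) ell2 \<Rightarrow> _)"
  unfolding bounded_clinear_def
proof (intro conjI allI bounded_linear_intro [of _ 1])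
  fix x y :: "('n list, 'a) ell2" and r c
  show "backshift i (x + y) = backshift i x + backshift i y"
    "backshift i (r *\<^sub>R x) = r *\<^sub>R backshift i x" "backshift i (c *\<^sub>C x) = c *\<^sub>C backshift i x"
    by (rule ell2_eqI, simp add: backshift.rep_eq plus_ell2.rep_eq scaleR_ell2.rep_eq
        scaleC_ell2.rep_eq)+
qed (simp add: norm_backshift_le)

lemma shift_tensor: "shift i (\<phi> \<otimes>\<^sub>h d) = shift i \<phi> \<otimes>\<^sub>h d"
  by (rule ell2_eqI) (simp add: shift.rep_eq tensor.rep_eq split: list.splits)

lemma backshift_tensor: "backshift i (\<phi> \<otimes>\<^sub>h d) = backshift i \<phi> \<otimes>\<^sub>h d"
  by (rule ell2_eqI) (simp add: backshift.rep_eq tensor.rep_eq)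

lemma shift_single: "shift i (single w d) = single (i # w) d"
  by (rule ell2_eqI) (auto simp: shift.rep_eq single.rep_eq split: list.splits)

lemma coord_sum: "coord (sum f A) w = (\<Sum>a\<in>A. coord (f a) w)"
  by (induction A rule: infinite_finite_induct) (simp_all add: zero_ell2.rep_eq plus_ell2.rep_eq)

text \<open>The Cuntz--Toeplitz relation \<open>I - \<Sum> S\<^sub>i S\<^sub>i\<^sup>* = P\<^sub>\<complex>\<close>, tensored with the identity.\<close>
lemma shift_backshift_decomposition:
  fixes x :: "('n :: finite list, 'a :: real_inner) ell2"
  shows "x = single [] (coord x []) + (\<Sum>i\<in>UNIV. shift i (backshift i x))"
proof (rule ell2_eqI)
  fix w
  show "coord x w = coord (single [] (coord x []) + (\<Sum>i\<in>UNIV. shift i (backshift i x))) w"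
    by (cases w) (simp_all add: plus_ell2.rep_eq coord_sum single.rep_eq shift.rep_eq
        backshift.rep_eq)
qed


section \<open>Tensor products of subspaces and ampliations\<close>

lemma csubspace_tensor_space: "csubspace (tensor_space N)"
  by (simp add: tensor_space_def csubspace_closure_cspan)

lemma closed_tensor_space: "closed (tensor_space N)"
  by (simp add: tensor_space_def)

lemma tensor_in_tensor_space: "\<phi> \<in> N \<Longrightarrow> \<phi> \<otimes>\<^sub>h d \<in> tensor_space N"
  unfolding tensor_space_def
  by (rule subsetD [OF subset_closure_cspan]) auto

lemma tensor_space_minimal:
  "(\<And>\<phi> d. \<phi> \<in> N \<Longrightarrow> \<phi> \<otimes>\<^sub>h d \<in> S) \<Longrightarrow> csubspace S \<Longrightarrow> closed S \<Longrightarrow> tensor_space N \<subseteq> S"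
  unfolding tensor_space_def by (rule closure_cspan_minimal) auto

lemma tensor_diff_left: "\<phi> \<otimes>\<^sub>h d - \<psi> \<otimes>\<^sub>h d = (\<phi> - \<psi>) \<otimes>\<^sub>h d"
  by (rule ell2_eqI)
    (simp add: tensor.rep_eq minus_ell2.rep_eq complex_vector.scale_left_diff_distrib)

text \<open>The remainder is the elementary tensor of \<open>\<phi> - proj N \<phi>\<close> with
  \<open>d\<close>. It is orthogonal to all elementary tensors over \<open>N\<close>, hence to their
  closed span.\<close>

lemma proj_tensor_space:
  fixes d :: "'d :: chilbert_space"
  assumes N: "csubspace N" "closed N"
  shows "proj (tensor_space N) (\<phi> \<otimes>\<^sub>h d) = proj N \<phi> \<otimes>\<^sub>h d"
proof (rule proj_eqI [OF csubspace_tensor_space])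
  show "proj N \<phi> \<otimes>\<^sub>h d \<in> tensor_space N"
    by (simp add: tensor_in_tensor_space proj_in N)
next
  let ?v = "\<phi> \<otimes>\<^sub>h d - proj N \<phi> \<otimes>\<^sub>h d"
  fix s :: "('a, 'd) ell2" assume s: "s \<in> tensor_space N"
  have "tensor_space N \<subseteq> {s. cinner ?v s = 0}"
  proof (rule tensor_space_minimal [OF _ csubspace_orth closed_orth])
    fix \<psi> and d' :: 'd assume "\<psi> \<in> N"
    then show "\<psi> \<otimes>\<^sub>h d' \<in> {s. cinner ?v s = 0}"
      by (simp add: tensor_diff_left cinner_tensor cinner_diff_left cinner_proj_left N)
  qed
  then show "cinner s ?v = 0"
    using s by (auto simp: cinner_eq_0_commute [of s])
qed

text \<open>Two candidates agree on every \<open>single i d\<close>, and the kernel of their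
  difference is a closed subspace, hence everything.\<close>

lemma ampliation_eqI:
  fixes A :: "('i, 'd :: chilbert_space) ell2 \<Rightarrow> ('i, 'd) ell2"
  assumes A: "bounded_clinear A" "\<And>\<phi> d. A (\<phi> \<otimes>\<^sub>h d) = T \<phi> \<otimes>\<^sub>h d"
  shows "ampliation T = A"
  unfolding ampliation_def
proof (rule the_equality)
  show "bounded_clinear A \<and> (\<forall>\<phi> d. A (\<phi> \<otimes>\<^sub>h d) = T \<phi> \<otimes>\<^sub>h d)"
    using A by blast
next
  fix A' :: "('i, 'd) ell2 \<Rightarrow> ('i, 'd) ell2"
  assume A': "bounded_clinear A' \<and> (\<forall>\<phi> d. A' (\<phi> \<otimes>\<^sub>h d) = T \<phi> \<otimes>\<^sub>h d)"
  have diff: "bounded_clinear (\<lambda>x. A' x - A x)"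
    using A A' by (auto simp: bounded_clinear_def bounded_linear_sub
        complex_vector.scale_right_diff_distrib)
  have eq: "A' (single i d) = A (single i d)" for i and d :: 'd
    using A(2) [of "single i 1" d] A' by (metis tensor_single)
  have "{x. A' x - A x \<in> {0}} = UNIV"
  proof (rule closed_csubspace_singles)
    show "single i d \<in> {x. A' x - A x \<in> {0}}" for i and d :: 'd
      by (simp add: eq)
  qed (use bounded_clinear_vimage [OF diff, of "{0}"] in simp_all)
  then show "A' = A"
    by (auto simp: fun_eq_iff)
qed

section \<open>The subspace of vacuum tensors and the projection onto it\<close>

text \<open>Described by vanishing coordinates, the copy of \<open>D\<close> is visibly a closed
  subspace.\<close>

lemma vacuum_range_eq:
  "range (\<lambda>d. vacuum \<otimes>\<^sub>h d) =
    {x :: ('n list, 'd :: complex_inner) ell2. \<forall>w. w \<noteq> [] \<longrightarrow> coord x w = 0}"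
proof (intro subset_antisym subsetI)
  fix x :: "('n list, 'd) ell2"
  assume x: "x \<in> {x. \<forall>w. w \<noteq> [] \<longrightarrow> coord x w = 0}"
  have "x = single [] (coord x [])"
    using x by (intro ell2_eqI) (simp add: single.rep_eq)
  then show "x \<in> range (\<lambda>d. vacuum \<otimes>\<^sub>h d)"
    unfolding vacuum_tensor by blast
qed (auto simp: vacuum_tensor single.rep_eq)

lemma bounded_clinear_coord:
  "bounded_clinear (\<lambda>x :: ('i, 'a :: complex_inner) ell2. coord x i)"
  unfolding bounded_clinear_def
  by (auto intro!: bounded_linear_intro [of _ 1]
      simp: plus_ell2.rep_eq scaleR_ell2.rep_eq scaleC_ell2.rep_eq norm_coord_le)

lemma csubspace_vacuum_range: "csubspace (range (\<lambda>d. vacuum \<otimes>\<^sub>h d))"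
  unfolding vacuum_range_eq complex_vector.subspace_def
  by (simp add: plus_ell2.rep_eq scaleC_ell2.rep_eq zero_ell2.rep_eq)

lemma closed_vacuum_range:
  "closed (range (\<lambda>d. vacuum \<otimes>\<^sub>h d) :: ('n list, 'd :: complex_inner) ell2 set)"
proof -
  have "range (\<lambda>d. vacuum \<otimes>\<^sub>h d) =
      (\<Inter>w\<in>- {[]}. {x :: ('n list, 'd) ell2. coord x w \<in> {0}})"
    unfolding vacuum_range_eq by auto
  also have "closed \<dots>"
    by (intro closed_INT ballI bounded_clinear_vimage(2) [OF bounded_clinear_coord]) auto
  finally show ?thesis .
qed

lemma proj_vacuum_range: "proj (range (\<lambda>d. vacuum \<otimes>\<^sub>h d)) x = single [] (coord x [])"
  by (rule proj_eqI [OF csubspace_vacuum_range])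
    (auto simp: vacuum_tensor cinner_single_left minus_ell2.rep_eq single.rep_eq)


section \<open>Constrained shifts\<close>

lemma creation_in_F_infty: "creation i \<in> F_infty"
  by (auto simp: F_infty_def hull_def)

lemma csubspace_N_space: "csubspace (N_space J)" and closed_N_space: "closed (N_space J)"
  by (simp_all add: N_space_def csubspace_orth_compl closed_orth_compl)

lemma in_N_space_iff: "\<phi> \<in> N_space J \<longleftrightarrow> (\<forall>T\<in>J. \<forall>\<psi>. cinner (T \<psi>) \<phi> = 0)"
proof -
  have "N_space J = orth_compl_in UNIV {T \<psi> | T \<psi>. T \<in> J}"
    unfolding N_space_def by (rule orth_compl_in_closure_cspan)
  then show ?thesis
    by (auto simp: orth_compl_in_def)
qed

text \<open>Moving \<open>backshift i\<close> to the other side of the inner product replaces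
  \<open>T\<close> by \<open>creation i \<circ> T\<close>, which again belongs to the ideal.\<close>

lemma backshift_in_N_space:
  assumes "two_sided_ideal F_infty J" "\<phi> \<in> N_space J"
  shows "backshift i \<phi> \<in> N_space J"
proof -
  have "cinner (T \<psi>) (backshift i \<phi>) = 0" if "T \<in> J" for T \<psi>
  proof -
    have "creation i \<circ> T \<in> J"
      using assms(1) creation_in_F_infty that unfolding two_sided_ideal_def by blast
    then have "cinner ((creation i \<circ> T) \<psi>) \<phi> = 0"
      using assms(2) unfolding in_N_space_iff by blast
    then show ?thesis
      by (simp add: creation_eq_shift cinner_shift)
  qed
  then show ?thesis
    unfolding in_N_space_iff by blast
qed

lemma backshift_in_tensor_space:
  assumes "two_sided_ideal F_infty J" "x \<in> tensor_space (N_space J)"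
  shows "backshift i x \<in> tensor_space (N_space J)"
proof -
  let ?X = "tensor_space (N_space J)"
  have "?X \<subseteq> {x. backshift i x \<in> ?X}"
    by (rule tensor_space_minimal)
      (simp_all add: backshift_tensor tensor_in_tensor_space backshift_in_N_space [OF assms(1)]
        bounded_clinear_vimage bounded_clinear_backshift csubspace_tensor_space
        closed_tensor_space)
  with assms(2) show ?thesis by blast
qed

text \<open>The operator \<open>P\<^sub>N \<otimes> I\<close> is the projection onto \<open>N \<otimes> D\<close>, so the ampliation exists.\<close>
lemma ampliation_B_op:
  "ampliation (B_op J i) = proj (tensor_space (N_space J)) \<circ> shift i"
  by (rule ampliation_eqI)
    (simp_all add: bounded_clinear_comp bounded_clinear_proj bounded_clinear_shift
      csubspace_tensor_space closed_tensor_space shift_tensor proj_tensor_space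
      csubspace_N_space closed_N_space B_op_def creation_eq_shift)

lemma adjoint_on_eqI:
  assumes X: "csubspace X" and y: "y \<in> X" "\<And>z. z \<in> X \<Longrightarrow> cinner (T z) x = cinner z y"
  shows "adjoint_on X T x = y"
  unfolding adjoint_on_def
proof (rule the_equality)
  fix y' assume y': "y' \<in> X \<and> (\<forall>z\<in>X. cinner (T z) x = cinner z y')"
  then have "y' - y \<in> X"
    using X y complex_vector.subspace_diff by blast
  then have "cinner (y' - y) y' = cinner (y' - y) y"
    using y y' by metis
  then have "cinner (y' - y) (y' - y) = 0"
    by (simp add: cinner_diff_right)
  then show "y' = y"
    by (simp add: cinner_self_eq_0)
qed (use y in blast)

text \<open>The compression of \<open>shift i\<close> to the tensor space has the compression of
  \<open>backshift i\<close> as adjoint; since \<open>backshift i\<close> preserves that space, no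
  projection remains.\<close>

lemma adjoint_on_ampliation_B_op:
  assumes "two_sided_ideal F_infty J" "x \<in> tensor_space (N_space J)"
  shows "adjoint_on (tensor_space (N_space J)) (ampliation (B_op J i)) x = backshift i x"
  by (rule adjoint_on_eqI)
    (simp_all add: csubspace_tensor_space closed_tensor_space backshift_in_tensor_space assms
      ampliation_B_op cinner_proj_left cinner_shift)

text \<open>The dual form of the invariance of \<open>X\<close> under \<open>backshift i\<close>. It
  makes compressed shifts act on projected basis vectors as shifts act on words.\<close>

lemma proj_shift_proj:
  fixes X :: "('n list, 'd :: chilbert_space) ell2 set"
  assumes X: "csubspace X" "closed X" and inv: "\<And>x. x \<in> X \<Longrightarrow> backshift i x \<in> X"
  shows "proj X (shift i (proj X u)) = proj X (shift i u)"
proof (rule proj_eqI [OF X(1)])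
  fix s assume s: "s \<in> X"
  have "cinner (shift i (proj X u)) s = cinner (shift i u) s"
    by (simp add: cinner_shift cinner_proj_left X inv s)
  then have "cinner s (shift i (proj X u)) = cinner s (shift i u)"
    by (metis cinner_commute)
  then show "cinner s (shift i (proj X u) - proj X (shift i u)) = 0"
    by (simp add: cinner_diff_right cinner_proj_right X s)
qed (simp add: proj_in X)

section \<open>The closed invariant subspace generated by a set\<close>

lemma unital_algebra_hull_minimal:
  "T \<in> unital_algebra hull Ts \<Longrightarrow> unital_algebra \<A> \<Longrightarrow> Ts \<subseteq> \<A> \<Longrightarrow> T \<in> \<A>"
  by (auto simp: hull_def)

lemma unital_algebra_hull: "unital_algebra (unital_algebra hull Ts)"
  by (rule hull_in) (simp add: unital_algebra_def)

lemma generated_space_invariant: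
  assumes B: "B \<in> Ts" "bounded_clinear B"
    and y: "y \<in> closure (cspan {T h | T h. T \<in> unital_algebra hull Ts \<and> h \<in> M})"
      (is "_ \<in> ?Y")
  shows "B y \<in> ?Y"
proof -
  have "?Y \<subseteq> {u. B u \<in> ?Y}"
  proof (rule closure_cspan_minimal)
    show "{T h | T h. T \<in> unital_algebra hull Ts \<and> h \<in> M} \<subseteq> {u. B u \<in> ?Y}"
    proof clarify
      fix T h assume "T \<in> unital_algebra hull Ts" "h \<in> M"
      moreover have "B \<in> unital_algebra hull Ts"
        using B hull_subset [of Ts unital_algebra] by blast
      ultimately have "B \<circ> T \<in> unital_algebra hull Ts"
        using unital_algebra_hull [of Ts] by (auto simp: unital_algebra_def)
      then have "(B \<circ> T) h \<in> {T h | T h. T \<in> unital_algebra hull Ts \<and> h \<in> M}"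
        using \<open>h \<in> M\<close> by blast
      then show "B (T h) \<in> ?Y"
        using subset_closure_cspan by fastforce
    qed
  qed (simp_all add: bounded_clinear_vimage B csubspace_closure_cspan)
  with y show ?thesis by blast
qed

lemma generated_space_superset:
  "M \<subseteq> closure (cspan {T h | T h. T \<in> unital_algebra hull Ts \<and> h \<in> M})"
proof
  fix h assume "h \<in> M"
  moreover have "id \<in> unital_algebra hull Ts"
    using unital_algebra_hull [of Ts] by (simp add: unital_algebra_def)
  ultimately have "id h \<in> {T h | T h. T \<in> unital_algebra hull Ts \<and> h \<in> M}"
    by blast
  then show "h \<in> closure (cspan {T h | T h. T \<in> unital_algebra hull Ts \<and> h \<in> M})"
    using subset_closure_cspan by fastforce
qed

text \<open>The operators that map \<open>X\<close> into itself form a unital algebra. This matters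
  because operators on \<open>X\<close> are represented by functions on the whole ambient
  space.\<close>

lemma generated_space_subset:
  assumes X: "csubspace X" "closed X" and M: "M \<subseteq> X" and Ts: "\<And>T. T \<in> Ts \<Longrightarrow> T ` X \<subseteq> X"
  shows "closure (cspan {T h | T h. T \<in> unital_algebra hull Ts \<and> h \<in> M}) \<subseteq> X"
proof (rule closure_cspan_minimal [OF _ X])
  have "unital_algebra {T. T ` X \<subseteq> X}"
    using X(1) by (auto simp: unital_algebra_def complex_vector.subspace_scale
        intro!: complex_vector.subspace_add)
  then show "{T h | T h. T \<in> unital_algebra hull Ts \<and> h \<in> M} \<subseteq> X"
    using unital_algebra_hull_minimal [of _ Ts "{T. T ` X \<subseteq> X}"] M Ts by blast
qed

text \<open>The vector \<open>v\<close> is a formal eigenvector of the adjoint of every generator,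
  with eigenvalue 0. Being such an eigenvector for some eigenvalue is preserved by the algebra
  operations and holds for the identity, so every \<open>T\<close> in the algebra sends
  \<open>M\<close> into the orthogonal complement of \<open>v\<close>.\<close>

lemma generated_space_orth:
  assumes v: "\<And>h. h \<in> M \<Longrightarrow> cinner v h = 0" and Ts: "\<And>T y. T \<in> Ts \<Longrightarrow> cinner v (T y) = 0"
    and y: "y \<in> closure (cspan {T h | T h. T \<in> unital_algebra hull Ts \<and> h \<in> M})"
  shows "cinner v y = 0"
proof -
  let ?A = "{T. \<exists>c. \<forall>y. cinner v (T y) = c * cinner v y}"
  have "unital_algebra ?A"
    unfolding unital_algebra_def
  proof (intro conjI ballI allI)
    show "id \<in> ?A"
      by (auto intro: exI [of _ 1])
  next
    fix S T assume "S \<in> ?A" "T \<in> ?A"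
    then obtain a b where "\<And>y. cinner v (S y) = a * cinner v y" "\<And>y. cinner v (T y) = b * cinner v y"
      by blast
    then have "\<forall>y. cinner v (S y + T y) = (a + b) * cinner v y"
      "\<forall>y. cinner v ((S \<circ> T) y) = (a * b) * cinner v y"
      by (simp_all add: cinner_add_right distrib_right)
    then show "(\<lambda>x. S x + T x) \<in> ?A" "S \<circ> T \<in> ?A"
      by blast+
  next
    fix c T assume "T \<in> ?A"
    then obtain b where "\<And>y. cinner v (T y) = b * cinner v y"
      by blast
    then have "\<forall>y. cinner v (c *\<^sub>C T y) = (c * b) * cinner v y"
      by (simp add: cinner_scaleC_right)
    then show "(\<lambda>x. c *\<^sub>C T x) \<in> ?A"
      by blast
  qed
  moreover have "Ts \<subseteq> ?A"
    using Ts by (auto intro: exI [of _ 0])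
  ultimately have hull: "T \<in> ?A" if "T \<in> unital_algebra hull Ts" for T
    by (rule unital_algebra_hull_minimal [OF that])
  have "cinner v (T h) = 0" if T: "T \<in> unital_algebra hull Ts" and "h \<in> M" for T h
  proof -
    obtain c where "\<forall>y. cinner v (T y) = c * cinner v y"
      using hull [OF T] by blast
    then show ?thesis
      using v [OF \<open>h \<in> M\<close>] by simp
  qed
  then have "closure (cspan {T h | T h. T \<in> unital_algebra hull Ts \<and> h \<in> M}) \<subseteq> {y. cinner v y = 0}"
    by (intro closure_cspan_minimal csubspace_orth closed_orth) auto
  with y show ?thesis by blast
qed

text \<open>For \<open>v\<close> in \<open>D\<close>, pairing with \<open>m\<close> is the same as
  pairing with \<open>proj D m\<close>. So the vectors of \<open>D\<close> orthogonal to
  \<open>M\<close> are exactly those orthogonal to the projected image of \<open>M\<close>.\<close>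

lemma closure_proj_image_eq_iff:
  fixes X :: "'a :: chilbert_space set"
  assumes X: "csubspace X" and D: "csubspace D" "closed D" "D \<subseteq> X" and M: "csubspace M"
  shows "closure (proj D ` M) = D \<longleftrightarrow> orth_compl_in X M \<inter> D = {0}"
proof
  assume dense: "closure (proj D ` M) = D"
  have "v = 0" if v: "v \<in> orth_compl_in X M" "v \<in> D" for v
  proof -
    have "cinner v (proj D m) = 0" if "m \<in> M" for m
    proof -
      have "cinner m v = 0"
        using v that by (simp add: orth_compl_in_def)
      then show ?thesis
        using v D cinner_eq_0_commute [of m v] by (simp add: cinner_proj_right)
    qed
    then have "proj D ` M \<subseteq> {y. cinner v y = 0}"
      by blast
    then have "closure (proj D ` M) \<subseteq> {y. cinner v y = 0}"
      by (rule closure_minimal) (rule closed_orth)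
    then have "D \<subseteq> {y. cinner v y = 0}"
      by (simp only: dense)
    with v show ?thesis
      by (auto simp: cinner_self_eq_0)
  qed
  moreover have "0 \<in> orth_compl_in X M" "0 \<in> D"
    using X D by (auto simp: orth_compl_in_def complex_vector.subspace_0)
  ultimately show "orth_compl_in X M \<inter> D = {0}"
    by blast
next
  assume triv: "orth_compl_in X M \<inter> D = {0}"
  interpret P: bounded_linear "proj D"
    using bounded_clinear_proj [OF D(1,2)] by (simp add: bounded_clinear_def)
  have "csubspace (proj D ` M)"
    unfolding complex_vector.subspace_def
  proof (intro conjI ballI allI)
    show "0 \<in> proj D ` M"
      using M P.zero complex_vector.subspace_0 by (metis image_eqI)
  next
    fix x y assume "x \<in> proj D ` M" "y \<in> proj D ` M"
    then show "x + y \<in> proj D ` M"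
      using M by (auto simp: complex_vector.subspace_add simp flip: P.add)
  next
    fix c x assume "x \<in> proj D ` M"
    then show "c *\<^sub>C x \<in> proj D ` M"
      using M bounded_clinear_proj [OF D(1,2)]
      by (auto simp: bounded_clinear_def complex_vector.subspace_scale
          intro!: image_eqI [of _ _ "c *\<^sub>C m" for m])
  qed
  then have Z: "csubspace (closure (proj D ` M))"
    by (rule csubspace_closure)
  show "closure (proj D ` M) = D"
  proof
    show sub: "closure (proj D ` M) \<subseteq> D"
      by (rule closure_minimal) (auto simp: proj_in D)
    show "D \<subseteq> closure (proj D ` M)"
    proof
      fix u assume u: "u \<in> D"
      \<comment> \<open>The part of \<open>u\<close> orthogonal to the closure of the projected
        image; it lies in \<open>D\<close> and is orthogonal to \<open>M\<close>, so it must
        vanish.\<close>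
      define v where "v = u - proj (closure (proj D ` M)) u"
      have p: "proj (closure (proj D ` M)) u \<in> closure (proj D ` M)"
        by (simp add: proj_in Z)
      then have vD: "v \<in> D"
        using complex_vector.subspace_diff [OF D(1) u] sub unfolding v_def by blast
      have "cinner m v = 0" if "m \<in> M" for m
      proof -
        have "proj D m \<in> closure (proj D ` M)"
          using that by (intro subsetD [OF closure_subset] imageI)
        then have "cinner (proj D m) v = 0"
          unfolding v_def by (intro cinner_diff_proj Z) simp_all
        then show ?thesis
          by (simp add: cinner_proj_left D vD)
      qed
      then have "v = 0"
        using triv vD D by (auto simp: orth_compl_in_def)
      with p show "u \<in> closure (proj D ` M)"
        by (simp add: v_def)
    qed
  qed
qed

text \<open>Condition (ii) is read as density of the image in \<open>D0\<close>: the projection of a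
  subspace, even of a closed one, need not be closed.\<close>

theorem corollary1p6:
  fixes J :: "('n :: finite fock \<Rightarrow> 'n fock) set"
    and M :: "('n list, 'd :: chilbert_space) ell2 set"
  defines "X \<equiv> tensor_space (N_space J) :: ('n list, 'd) ell2 set"
    and "Bs \<equiv> range (\<lambda>i. ampliation (B_op J i)) :: (('n list, 'd) ell2 \<Rightarrow> ('n list, 'd) ell2) set"
    and "D0 \<equiv> range (\<lambda>d. vacuum \<otimes>\<^sub>h d) :: ('n list, 'd) ell2 set"
  assumes "two_sided_ideal F_infty J" and "closedin wot J"
    and "vacuum \<in> N_space J"
    and "csubspace M" and "M \<subseteq> X" and "co_invariant_on X Bs M"
  shows "(cyclic_on X Bs M \<longleftrightarrow> closure (proj D0 ` M) = D0) \<and>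
         (closure (proj D0 ` M) = D0 \<longleftrightarrow> orth_compl_in X M \<inter> D0 = {0})"
proof -
  have X: "csubspace X" "closed X"
    by (simp_all add: X_def csubspace_tensor_space closed_tensor_space)
  have D0: "csubspace D0" "closed D0"
    by (simp_all add: D0_def csubspace_vacuum_range closed_vacuum_range)
  have "D0 \<subseteq> X"
    using \<open>vacuum \<in> N_space J\<close> by (auto simp: D0_def X_def tensor_in_tensor_space)
  have single_D0: "single [] d \<in> D0" for d
    unfolding D0_def vacuum_tensor by blast
  have projD0: "proj D0 x = single [] (coord x [])" for x
    unfolding D0_def by (rule proj_vacuum_range)
  have Bs: "Bs = range (\<lambda>i. proj X \<circ> shift i)"
    by (simp add: Bs_def X_def ampliation_B_op)
  have backshift_X: "backshift i x \<in> X" if "x \<in> X" for i x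
    using backshift_in_tensor_space assms(4) that unfolding X_def by blast
  have backshift_M: "backshift i x \<in> M" if "x \<in> M" for i x
  proof -
    have "adjoint_on X (ampliation (B_op J i)) x \<in> M"
      using \<open>co_invariant_on X Bs M\<close> that by (auto simp: co_invariant_on_def Bs_def)
    moreover have "x \<in> X"
      using that \<open>M \<subseteq> X\<close> by blast
    ultimately show ?thesis
      using adjoint_on_ampliation_B_op [OF assms(4), of x i] by (simp add: X_def)
  qed
  have iii: "closure (proj D0 ` M) = D0 \<longleftrightarrow> orth_compl_in X M \<inter> D0 = {0}"
    by (rule closure_proj_image_eq_iff) fact+
  \<comment> \<open>Cyclicity of \<open>M\<close> says precisely \<open>Y = X\<close>.\<close>
  define Y where "Y = closure (cspan {T h | T h. T \<in> unital_algebra hull Bs \<and> h \<in> M})"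
  have Y: "csubspace Y" "closed Y"
    by (simp_all add: Y_def csubspace_closure_cspan)
  have "M \<subseteq> Y"
    unfolding Y_def by (rule generated_space_superset)
  have "Y \<subseteq> X"
    unfolding Y_def
    by (rule generated_space_subset) (use X \<open>M \<subseteq> X\<close> in \<open>auto simp: Bs proj_in\<close>)
  have invY: "proj X (shift i y) \<in> Y" if "y \<in> Y" for i y
  proof -
    have "proj X \<circ> shift i \<in> Bs" "bounded_clinear (proj X \<circ> shift i)"
      by (auto simp: Bs bounded_clinear_comp bounded_clinear_proj X bounded_clinear_shift)
    from generated_space_invariant [OF this] that have "(proj X \<circ> shift i) y \<in> Y"
      unfolding Y_def .
    then show ?thesis by simp
  qed
  \<comment> \<open>(i) implies (iii): a vector of \<open>D0\<close> orthogonal to \<open>M\<close>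
    is orthogonal to \<open>Y\<close>; if \<open>Y = X\<close>, it is orthogonal to itself.\<close>
  have "orth_compl_in X M \<inter> D0 = {0}" if "Y = X"
  proof -
    have "v = 0" if v: "v \<in> orth_compl_in X M" "v \<in> D0" for v
    proof -
      obtain d where d: "v = single [] d"
        using v(2) by (auto simp: D0_def vacuum_tensor)
      have "v \<in> Y"
        using v \<open>D0 \<subseteq> X\<close> \<open>Y = X\<close> by blast
      have "cinner v v = 0"
      proof (rule generated_space_orth)
        show "cinner v h = 0" if "h \<in> M" for h
          using v(1) that cinner_eq_0_commute [of h v] by (simp add: orth_compl_in_def)
        show "cinner v (T y) = 0" if T: "T \<in> Bs" for T y
        proof -
          obtain i where "T = proj X \<circ> shift i"
            using T unfolding Bs by blast
          then have "cinner v (T y) = cinner v (shift i y)"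
            using v \<open>D0 \<subseteq> X\<close> by (auto simp: cinner_proj_right X)
          \<comment> \<open>A shifted family has coordinate 0 at the empty word, the only place
            where \<open>v\<close> lives.\<close>
          then show ?thesis
            by (simp add: d cinner_single_left shift.rep_eq)
        qed
        show "v \<in> closure (cspan {T h | T h. T \<in> unital_algebra hull Bs \<and> h \<in> M})"
          using \<open>v \<in> Y\<close> unfolding Y_def .
      qed
      then show ?thesis
        by (simp add: cinner_self_eq_0)
    qed
    moreover have "0 \<in> orth_compl_in X M" "0 \<in> D0"
      using X D0 by (auto simp: orth_compl_in_def complex_vector.subspace_0)
    ultimately show ?thesis by blast
  qed
  \<comment> \<open>(ii) implies (i).\<close>
  moreover have "Y = X" if dense: "closure (proj D0 ` M) = D0"
  proof -
    have "proj D0 m \<in> Y" if "m \<in> M" for m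
    proof -
      interpret P: bounded_linear "proj X"
        using bounded_clinear_proj [OF X] by (simp add: bounded_clinear_def)
      \<comment> \<open>The Cuntz-Toeplitz decomposition is compressed to \<open>X\<close>:
        \<open>proj X\<close> fixes \<open>m\<close> and its vacuum part, so
        \<open>proj D0 m\<close> becomes \<open>m\<close> minus the compressed shifts of the vectors
        \<open>backshift i m\<close>. These lie in \<open>M\<close> by co-invariance, so all terms
        are in \<open>Y\<close>.\<close>
      have "m = proj X (single [] (coord m []) + (\<Sum>i\<in>UNIV. shift i (backshift i m)))"
        using that \<open>M \<subseteq> X\<close> by (subst shift_backshift_decomposition [symmetric])
          (auto simp: proj_ident X)
      also have "\<dots> = proj D0 m + (\<Sum>i\<in>UNIV. proj X (shift i (backshift i m)))"
        using single_D0 \<open>D0 \<subseteq> X\<close> by (simp add: P.add P.sum proj_ident X projD0 subset_iff)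
      finally have "proj D0 m = m - (\<Sum>i\<in>UNIV. proj X (shift i (backshift i m)))"
        by (simp add: algebra_simps)
      moreover have "m \<in> Y"
        using that \<open>M \<subseteq> Y\<close> by blast
      moreover have "(\<Sum>i\<in>UNIV. proj X (shift i (backshift i m))) \<in> Y"
        using backshift_M that \<open>M \<subseteq> Y\<close>
        by (intro complex_vector.subspace_sum Y invY) blast
      ultimately show ?thesis
        using Y by (simp add: complex_vector.subspace_diff)
    qed
    then have "closure (proj D0 ` M) \<subseteq> Y"
      by (intro closure_minimal Y) auto
    then have "D0 \<subseteq> Y"
      by (simp add: dense)
    \<comment> \<open>Induction on the word: prefixing \<open>i\<close> to \<open>w\<close> amounts,
      after projecting, to applying the compressed shift, under which \<open>Y\<close> is
      invariant.\<close>
    have words: "proj X (single w d) \<in> Y" for w d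
    proof (induction w)
      case Nil
      then show ?case
        using single_D0 \<open>D0 \<subseteq> X\<close> \<open>D0 \<subseteq> Y\<close> by (metis X(1) proj_ident subsetD)
    next
      case (Cons i w)
      then have "proj X (shift i (proj X (single w d))) \<in> Y"
        by (rule invY)
      then show ?case
        by (simp add: proj_shift_proj X backshift_X shift_single)
    qed
    \<comment> \<open>The vectors \<open>single w d\<close> span a dense subspace of the ambient
      space, and the preimage of \<open>Y\<close> under \<open>proj X\<close> is closed.\<close>
    have "{u. proj X u \<in> Y} = UNIV"
      by (rule closed_csubspace_singles)
        (simp_all add: words bounded_clinear_vimage bounded_clinear_proj X Y)
    then have "X \<subseteq> Y"
      using proj_ident [OF X(1)] by (metis (mono_tags) UNIV_I mem_Collect_eq subsetI)
    with \<open>Y \<subseteq> X\<close> show ?thesis by blast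
  qed
  ultimately have "cyclic_on X Bs M \<longleftrightarrow> closure (proj D0 ` M) = D0"
    using iii by (auto simp: cyclic_on_def simp flip: Y_def)
  with iii show ?thesis by blast
qed

end
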